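(* For any $f\in H^\uparrow$, the condition $\mathrm{card}(S_f)=1$ holds if and only if there are $M>0$ and $\varepsilon>0$ such that for all but finitely many $n\in\omega$ we have $$\frac{f(n+\lfloor\varepsilon f(n)\rfloor)}{f(n)}\leq M.$$
   Context: $\omega=\{0,1,2,\ldots\}$ and $n\in\omega$ is identified with $\{0,\ldots,n-1\}$. $G$ is the set of all functions $g\colon\omega\to(0,\infty)$ such that $g(n)\to\infty$ and $\frac{n}{g(n)}\not\to 0$. For $g\in G$, $\mathcal{Z}_g=\{A\subseteq\omega:\ \lim_{n\to\infty}\frac{\mathrm{card}(A\cap n)}{g(n)}=0\}$. $H^\uparrow$ is the set of all nondecreasing $g\in G$ with values in $\omega$. For $f\in H^\uparrow$, $S_f=\{g\in H^\uparrow:\ \mathcal{Z}_f=\mathcal{Z}_g\}/R$ is the set of equivalence classes of the equivalence relation $R$ given by $gRh\iff\limsup_{n\to\infty}\frac{g(n)}{h(n)}<\infty$ and $\limsup_{n\to\infty}\frac{h(n)}{g(n)}<\infty$. *)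

theory Defs
  imports Complex_Main "HOL-Library.Extended_Real" "HOL-Library.Liminf_Limsup"
begin

definition G :: "(nat \<Rightarrow> real) set" where
  "G = {g. (\<forall>n. g n > 0) \<and> filterlim g at_top sequentially
         \<and> \<not> ((\<lambda>n. real n / g n) \<longlonglongrightarrow> 0)}"

text \<open>The natural number \<open>n\<close>, as a set, is \<open>{..<n}\<close>.\<close>

definition Z :: "(nat \<Rightarrow> real) \<Rightarrow> nat set set" where
  "Z g = {A. (\<lambda>n. real (card (A \<inter> {..<n})) / g n) \<longlonglongrightarrow> 0}"

definition H_up :: "(nat \<Rightarrow> real) set" where
  "H_up = {g \<in> G. mono g \<and> range g \<subseteq> \<nat>}"

definition same_ideal :: "(nat \<Rightarrow> real) \<Rightarrow> (nat \<Rightarrow> real) set" where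
  "same_ideal f = {g \<in> H_up. Z f = Z g}"

text \<open>The upper limits are taken in the extended reals, where they always exist.
  The relation is restricted to \<^term>\<open>A\<close> so that its classes are subsets of \<^term>\<open>A\<close>.\<close>

definition R_on :: "(nat \<Rightarrow> real) set \<Rightarrow> ((nat \<Rightarrow> real) \<times> (nat \<Rightarrow> real)) set" where
  "R_on A = {(g, h). g \<in> A \<and> h \<in> A
     \<and> limsup (\<lambda>n. ereal (g n / h n)) < \<infinity>
     \<and> limsup (\<lambda>n. ereal (h n / g n)) < \<infinity>}"

definition S :: "(nat \<Rightarrow> real) \<Rightarrow> (nat \<Rightarrow> real) set set" where
  "S f = same_ideal f // R_on (same_ideal f)"

lemma limsup_ereal_less_infinity_iff:
  "limsup (\<lambda>n. ereal (u n)) < \<infinity> \<longleftrightarrow> (\<exists>C. \<forall>\<^sub>F n in sequentially. u n \<le> C)"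
proof
  assume "limsup (\<lambda>n. ereal (u n)) < \<infinity>"
  then obtain C where "limsup (\<lambda>n. ereal (u n)) < ereal C"
    using less_PInf_Ex_of_nat by auto
  then have "\<forall>\<^sub>F n in sequentially. ereal (u n) < ereal C"
    by (rule Limsup_lessD)
  then show "\<exists>C. \<forall>\<^sub>F n in sequentially. u n \<le> C"
    by (auto elim!: eventually_mono intro!: exI[of _ C])
next
  assume "\<exists>C. \<forall>\<^sub>F n in sequentially. u n \<le> C"
  then obtain C where "\<forall>\<^sub>F n in sequentially. ereal (u n) \<le> ereal C" by auto
  then have "limsup (\<lambda>n. ereal (u n)) \<le> ereal C" by (rule Limsup_bounded)
  also have "ereal C < \<infinity>" by simp
  finally show "limsup (\<lambda>n. ereal (u n)) < \<infinity>" .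
qed

lemma limsup_ratio_trans:
  fixes g h k :: "nat \<Rightarrow> real"
  assumes pos: "\<And>n. g n > 0" "\<And>n. h n > 0" "\<And>n. k n > 0"
    and "limsup (\<lambda>n. ereal (g n / h n)) < \<infinity>" "limsup (\<lambda>n. ereal (h n / k n)) < \<infinity>"
  shows "limsup (\<lambda>n. ereal (g n / k n)) < \<infinity>"
proof -
  obtain C D where C: "\<forall>\<^sub>F n in sequentially. g n / h n \<le> C"
    and D: "\<forall>\<^sub>F n in sequentially. h n / k n \<le> D"
    using assms(4,5) unfolding limsup_ereal_less_infinity_iff by auto
  have "\<forall>\<^sub>F n in sequentially. g n / k n \<le> C * D"
    using C D
  proof eventually_elim
    case (elim n)
    have "0 \<le> g n / h n" "0 \<le> h n / k n"
      using pos[of n] by simp_all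
    then have "(g n / h n) * (h n / k n) \<le> C * D"
      using elim by (intro mult_mono) auto
    then show ?case using pos(2)[of n] by simp
  qed
  then show ?thesis unfolding limsup_ereal_less_infinity_iff by auto
qed

lemma equiv_R_on:
  assumes "A \<subseteq> G"
  shows "equiv A (R_on A)"
proof (rule equivI)
  have pos: "g n > 0" if "g \<in> A" for g n
    using that assms by (auto simp: G_def)
  show "R_on A \<subseteq> A \<times> A" by (auto simp: R_on_def)
  show "refl_on A (R_on A)"
  proof (rule refl_onI)
    fix g assume g: "g \<in> A"
    have "g n / g n \<le> 1" for n using pos[OF g, of n] by simp
    then have "limsup (\<lambda>n. ereal (g n / g n)) < \<infinity>"
      unfolding limsup_ereal_less_infinity_iff by (intro exI[of _ 1]) auto
    then show "(g, g) \<in> R_on A" using g unfolding R_on_def by blast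
  qed
  show "sym (R_on A)" unfolding R_on_def sym_def by blast
  show "trans (R_on A)"
  proof (rule transI)
    fix g h k assume gh: "(g, h) \<in> R_on A" and hk: "(h, k) \<in> R_on A"
    then have A: "g \<in> A" "h \<in> A" "k \<in> A" by (auto simp: R_on_def)
    show "(g, k) \<in> R_on A"
      using gh hk A limsup_ratio_trans[of g h k] limsup_ratio_trans[of k h g] pos
      by (simp add: R_on_def)
  qed
qed

end

(* Everything rests on sets that are unions of sparse blocks {a..<b}. Such a set lies in Z f as soon
   as b - a is o(f a), and it lies outside Z g as soon as b - a is at least a fixed multiple of g b.
   Under the growth condition, f changes by at most a constant factor over a block of length
   comparable to f, both to the right and to the left of a point; so if f / g or g / f is unbounded,
   blocks of length about g n ending at n, respectively of length about f n starting at n, separate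
   the two ideals. If the growth condition fails, f increases by arbitrarily large factors on
   infinitely many blocks of length o(f); flattening f on these blocks leaves the ideal unchanged
   but changes the equivalence class. *)

theory Submission
  imports Defs
begin

section \<open>Sets built from sparse blocks\<close>

text \<open>Block \<open>k\<close> is taken with \<delta> = 1/(k+1), and so far to the right that
  everything below the end of block \<open>k - 1\<close> is negligible against \<open>f\<close> at
  its start. Hence only the latest block can matter for \<open>f\<close>, and it is short. At its
  right end, each block alone keeps the quotient by \<open>g\<close> at \<open>c\<close> or
  more.\<close>

lemma exists_block_set:
  fixes f g :: "nat \<Rightarrow> real"
  assumes f: "\<And>n. f n > 0" "mono f" "filterlim f at_top sequentially"
    and g: "\<And>n. g n > 0" and c: "c > 0"
    and blocks: "\<And>\<delta> N. \<delta> > 0 \<Longrightarrow>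
      \<exists>a b. N \<le> a \<and> a \<le> b \<and> real b - real a \<le> \<delta> * f a \<and> c * g b \<le> real b - real a"
  shows "\<exists>A. A \<in> Z f \<and> A \<notin> Z g"
proof -
  define P where "P k ab \<longleftrightarrow> k \<le> fst ab \<and> fst ab \<le> snd ab
      \<and> real (snd ab) - real (fst ab) \<le> f (fst ab) / real (Suc k)
      \<and> c * g (snd ab) \<le> real (snd ab) - real (fst ab)" for k and ab :: "nat \<times> nat"
  \<comment> \<open>This is the sparseness of the blocks: the crude bound \<open>snd ab\<close> for
    the number of elements contributed by all blocks up to \<open>ab\<close> is already small
    against \<open>f\<close> at the start of the next block.\<close>
  define Q where "Q k ab ab' \<longleftrightarrow> snd ab \<le> fst ab' \<and> real (snd ab) \<le> f (fst ab') / real (Suc k)"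
    for k and ab ab' :: "nat \<times> nat"
  have ex: "\<exists>ab'. P k ab' \<and> N \<le> fst ab'" for k N
    using blocks[of "1 / real (Suc k)" "max k N"] unfolding P_def by fastforce
  have "\<exists>s. \<forall>k. P k (s k) \<and> Q k (s k) (s (Suc k))"
  proof (rule dependent_nat_choice)
    show "\<exists>x. P 0 x" using ex by blast
  next
    fix x :: "nat \<times> nat" and k
    obtain N where N: "\<And>n. n \<ge> N \<Longrightarrow> f n \<ge> real (snd x) * real (Suc k)"
      using f(3) unfolding filterlim_at_top eventually_sequentially by meson
    obtain y where y: "P (Suc k) y" "max N (snd x) \<le> fst y" using ex by blast
    have "real (snd x) \<le> f (fst y) / real (Suc k)"
      using N[of "fst y"] y(2) by (simp add: pos_le_divide_eq)
    then have "Q k x y" using y(2) by (simp add: Q_def)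
    then show "\<exists>y. P (Suc k) y \<and> Q k x y" using y(1) by blast
  qed
  then obtain s where s: "\<And>k. P k (s k)" "\<And>k. Q k (s k) (s (Suc k))" by blast
  define a b where "a k = fst (s k)" and "b k = snd (s k)" for k
  have ab: "k \<le> a k" "a k \<le> b k" "real (b k) - real (a k) \<le> f (a k) / real (Suc k)"
    "c * g (b k) \<le> real (b k) - real (a k)" for k
    using s(1)[of k] by (auto simp: P_def a_def b_def)
  have step: "b k \<le> a (Suc k)" "real (b k) \<le> f (a (Suc k)) / real (Suc k)" for k
    using s(2)[of k] by (auto simp: Q_def a_def b_def)
  have b_mono: "b i \<le> b j" if "i \<le> j" for i j
    by (rule lift_Suc_mono_le[of b, OF order_trans[OF step(1) ab(2)] that])
  define A where "A = (\<Union>k. {a k..<b k})"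
  have bound: "real (card (A \<inter> {..<n})) / f n \<le> 2 / real (Suc K)" if n: "n \<ge> a (Suc K)" for n K
  proof -
    \<comment> \<open>Block \<open>k\<close> is the last one that starts at or before
      \<open>n\<close>; \<open>k \<le> a k\<close> makes the maximum exist. Since
      \<open>n \<ge> a (Suc K)\<close>, there is a previous block \<open>j\<close>, and
      \<open>j \<ge> K\<close>.\<close>
    define k where "k = Max {k. a k \<le> n}"
    have fin: "finite {k. a k \<le> n}"
      by (rule finite_subset[of _ "{..n}"]) (auto intro: order_trans[OF ab(1)])
    have "a k \<le> n" using Max_in[OF fin] n unfolding k_def by blast
    have kmax: "i \<le> k" if "a i \<le> n" for i
      using Max_ge[OF fin] that unfolding k_def by blast
    have "Suc K \<le> k" using kmax n by blast
    then obtain j where j: "k = Suc j" "K \<le> j" by (cases k) auto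
    \<comment> \<open>Block \<open>k\<close> is counted in full even if \<open>n\<close> cuts
      through it. This costs nothing, because its length is measured against
      \<open>f (a k) \<le> f n\<close>.\<close>
    have "A \<inter> {..<n} \<subseteq> {..<b j} \<union> {a k..<b k}"
    proof
      fix x assume "x \<in> A \<inter> {..<n}"
      then obtain i where i: "a i \<le> x" "x < b i" "x < n" by (auto simp: A_def)
      then have "i \<le> k" using kmax by simp
      then show "x \<in> {..<b j} \<union> {a k..<b k}"
        using i j(1) b_mono[of i j] by (cases "i = k") auto
    qed
    then have "card (A \<inter> {..<n}) \<le> card ({..<b j} \<union> {a k..<b k})"
      by (intro card_mono) auto
    also have "\<dots> \<le> b j + (b k - a k)"
      using card_Un_le[of "{..<b j}" "{a k..<b k}"] by simp
    finally have "real (card (A \<inter> {..<n})) \<le> real (b j) + (real (b k) - real (a k))"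
      using ab(2)[of k] by linarith
    also have "\<dots> \<le> f (a k) / real (Suc j) + f (a k) / real (Suc k)"
      using step(2)[of j] ab(3)[of k] j(1) by simp
    also have "\<dots> \<le> f n / real (Suc K) + f n / real (Suc K)"
      using j f(1)[of "a k"] monoD[OF f(2) \<open>a k \<le> n\<close>] by (intro add_mono frac_le) auto
    finally show ?thesis using f(1)[of n] by (simp add: divide_simps mult.commute)
  qed
  have "A \<in> Z f"
    unfolding Z_def mem_Collect_eq
  proof (rule LIMSEQ_I)
    fix \<delta> :: real assume "\<delta> > 0"
    then obtain K where K: "inverse (real (Suc K)) < \<delta> / 2"
      using reals_Archimedean[of "\<delta> / 2"] by auto
    have "norm (real (card (A \<inter> {..<n})) / f n - 0) < \<delta>" if "n \<ge> a (Suc K)" for n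
    proof -
      have "2 / real (Suc K) < \<delta>" using K divide_inverse[of 2 "real (Suc K)"] by linarith
      then have "real (card (A \<inter> {..<n})) / f n < \<delta>"
        by (rule order_le_less_trans[OF bound[OF that]])
      moreover have "real (card (A \<inter> {..<n})) / f n \<ge> 0"
        using less_imp_le[OF f(1)] by (intro divide_nonneg_nonneg) auto
      ultimately show ?thesis unfolding real_norm_def by linarith
    qed
    then show "\<exists>N. \<forall>n\<ge>N. norm (real (card (A \<inter> {..<n})) / f n - 0) < \<delta>" by blast
  qed
  moreover have "A \<notin> Z g"
  proof
    assume "A \<in> Z g"
    then have "\<forall>\<^sub>F n in sequentially. real (card (A \<inter> {..<n})) / g n < c"
      using c unfolding Z_def mem_Collect_eq by (rule order_tendstoD(2))
    then obtain N where N: "\<And>n. n \<ge> N \<Longrightarrow> real (card (A \<inter> {..<n})) / g n < c"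
      unfolding eventually_sequentially by blast
    \<comment> \<open>The quotient is tested at the right ends \<open>b N\<close>, which are
      arbitrarily large.\<close>
    have "card {a N..<b N} \<le> card (A \<inter> {..<b N})"
      by (intro card_mono) (auto simp: A_def)
    then have "real (b N) - real (a N) \<le> real (card (A \<inter> {..<b N}))" by simp
    then have "c * g (b N) \<le> real (card (A \<inter> {..<b N}))" using ab(4)[of N] by linarith
    moreover have "N \<le> b N" using order_trans[OF ab(1,2)] .
    ultimately show False using N[of "b N"] g[of "b N"] by (simp add: pos_divide_less_eq)
  qed
  ultimately show ?thesis by blast
qed

section \<open>The growth condition makes equal ideals come from equivalent functions\<close>

text \<open>The growth condition only looks to the right of a point; blocks that end at a given
  \<open>n\<close> need control to its left. The last \<open>p\<close> whose jump
  \<open>p + nat \<lfloor>\<epsilon> * f p\<rfloor>\<close> falls short of \<open>n\<close> serves: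
  the jump from \<open>Suc p\<close> reaches \<open>n\<close>, and two uses of the condition give
  the factor \<open>M\<^sup>2\<close>.\<close>

lemma bounded_backward_growth:
  fixes f :: "nat \<Rightarrow> real"
  assumes f: "\<And>n. f n > 0" "mono f" "filterlim f at_top sequentially"
    and M: "M > 0" and \<epsilon>: "\<epsilon> > 0"
    and growth: "\<forall>\<^sub>F n in sequentially. f (n + nat \<lfloor>\<epsilon> * f n\<rfloor>) / f n \<le> M"
  shows "\<forall>\<^sub>F n in sequentially. \<exists>p\<ge>N. p < n \<and> \<epsilon> * f p < real n - real p \<and> f n \<le> M\<^sup>2 * f p"
proof -
  obtain N1 where N1: "\<And>n. n \<ge> N1 \<Longrightarrow> f (n + nat \<lfloor>\<epsilon> * f n\<rfloor>) / f n \<le> M"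
    using growth unfolding eventually_sequentially by blast
  have N1': "f (n + nat \<lfloor>\<epsilon> * f n\<rfloor>) \<le> M * f n" if "n \<ge> N1" for n
    using N1[OF that] f(1)[of n] by (simp add: pos_divide_le_eq)
  obtain N2 where N2: "\<And>n. n \<ge> N2 \<Longrightarrow> f n \<ge> 1 / \<epsilon>"
    using f(3) unfolding filterlim_at_top eventually_sequentially by meson
  define N0 where "N0 = max N (max N1 N2)"
  have "\<exists>p\<ge>N. p < n \<and> \<epsilon> * f p < real n - real p \<and> f n \<le> M\<^sup>2 * f p"
    \<comment> \<open>This bound puts \<open>N0\<close> into the set \<open>X\<close> below, so its
      maximum exists and is at least \<open>N0\<close>, where the growth bound applies.\<close>
    if n: "n > N0 + nat \<lfloor>\<epsilon> * f N0\<rfloor>" for n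
  proof -
    define X where "X = {p. p + nat \<lfloor>\<epsilon> * f p\<rfloor> < n}"
    have fin: "finite X" by (rule finite_subset[of _ "{..n}"]) (auto simp: X_def)
    define p where "p = Max X"
    have N0X: "N0 \<in> X" using n by (simp add: X_def)
    then have pX: "p \<in> X" using Max_in[OF fin] unfolding p_def by blast
    have p0: "p \<ge> N0" using Max_ge[OF fin N0X] unfolding p_def .
    have "Suc p \<notin> X" using Max_ge[OF fin, of "Suc p"] unfolding p_def by auto
    then have "n \<le> Suc p + nat \<lfloor>\<epsilon> * f (Suc p)\<rfloor>" by (simp add: X_def)
    then have "f n \<le> f (Suc p + nat \<lfloor>\<epsilon> * f (Suc p)\<rfloor>)" using f(2) by (rule monoD[rotated])
    also have "\<dots> \<le> M * f (Suc p)" using N1'[of "Suc p"] p0 by (simp add: N0_def)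
    \<comment> \<open>Beyond \<open>N2\<close> the jump has length at least 1, so
      \<open>Suc p\<close> lies within the jump from \<open>p\<close>, and the growth bound at
      \<open>p\<close> covers it.\<close>
    also have "f (Suc p) \<le> f (p + nat \<lfloor>\<epsilon> * f p\<rfloor>)"
    proof (rule monoD[OF f(2)])
      have "\<epsilon> * f p \<ge> 1" using N2[of p] p0 \<epsilon> by (simp add: N0_def field_simps)
      then have "\<lfloor>\<epsilon> * f p\<rfloor> \<ge> 1" by simp
      then show "Suc p \<le> p + nat \<lfloor>\<epsilon> * f p\<rfloor>" by linarith
    qed
    also have "f (p + nat \<lfloor>\<epsilon> * f p\<rfloor>) \<le> M * f p" using N1'[of p] p0 by (simp add: N0_def)
    finally have "f n \<le> M\<^sup>2 * f p" using M by (simp add: power2_eq_square mult.assoc)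
    moreover have "p < n" "\<epsilon> * f p < real n - real p"
    proof -
      show "p < n" using pX by (simp add: X_def)
      \<comment> \<open>An integer that exceeds the floor of a number exceeds the number
        itself.\<close>
      have "int p + \<lfloor>\<epsilon> * f p\<rfloor> < int n" using pX unfolding X_def by auto
      then show "\<epsilon> * f p < real n - real p" by linarith
    qed
    moreover have "p \<ge> N" using p0 by (simp add: N0_def)
    ultimately show ?thesis by blast
  qed
  then show ?thesis
    unfolding eventually_sequentially by (intro exI[of _ "Suc (N0 + nat \<lfloor>\<epsilon> * f N0\<rfloor>)"]) auto
qed

lemma not_eventually_ratio_le:
  fixes f g :: "nat \<Rightarrow> real"
  assumes "\<And>n. g n > 0" "limsup (\<lambda>n. ereal (f n / g n)) = \<infinity>"
  shows "\<exists>n\<ge>N. f n > C * g n"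
proof -
  have "\<not> (\<forall>\<^sub>F n in sequentially. f n / g n \<le> C)"
    using assms(2) limsup_ereal_less_infinity_iff[of "\<lambda>n. f n / g n"] by auto
  then obtain n where "n \<ge> N" "\<not> f n / g n \<le> C" unfolding eventually_sequentially by blast
  then show ?thesis using assms(1)[of n] by (auto simp: pos_divide_le_eq not_le)
qed

lemma H_upD:
  assumes "f \<in> H_up"
  shows "f n > 0" "mono f" "filterlim f at_top sequentially"
  using assms by (auto simp: H_up_def G_def)

text \<open>Where \<open>f n\<close> is huge compared with \<open>g n\<close>, the block of length
  \<open>g n\<close> ending at \<open>n\<close> is large for \<open>g\<close>. Backward growth keeps
  \<open>f\<close> at its left end comparable to \<open>f n\<close>, so the same block is short for
  \<open>f\<close>.\<close>

lemma growth_imp_limsup_finite: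
  assumes f: "f \<in> H_up" and g: "g \<in> H_up" and Z: "Z f \<subseteq> Z g"
    and M: "M > 0" and \<epsilon>: "\<epsilon> > 0"
    and growth: "\<forall>\<^sub>F n in sequentially. f (n + nat \<lfloor>\<epsilon> * f n\<rfloor>) / f n \<le> M"
  shows "limsup (\<lambda>n. ereal (f n / g n)) < \<infinity>"
proof (rule ccontr)
  note fD = H_upD[OF f] and gD = H_upD[OF g]
  assume "\<not> ?thesis"
  then have unb: "\<exists>n\<ge>N. f n > C * g n" for C N
    using not_eventually_ratio_le[of g f] gD(1) by simp
  have "\<exists>A. A \<in> Z f \<and> A \<notin> Z g"
  proof (rule exists_block_set[OF fD gD(1) zero_less_one])
    fix \<delta> :: real and N :: nat assume \<delta>: "\<delta> > 0"
    obtain N0 where N0: "\<And>n. n \<ge> N0 \<Longrightarrow>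
        \<exists>p\<ge>N. p < n \<and> \<epsilon> * f p < real n - real p \<and> f n \<le> M\<^sup>2 * f p"
      using bounded_backward_growth[OF fD M \<epsilon> growth, of N] unfolding eventually_sequentially by blast
    \<comment> \<open>The first entry makes the block short relative to \<open>f\<close>; the second
      keeps it to the right of \<open>p\<close>, where \<open>f\<close> is still at least
      \<open>f p\<close>.\<close>
    define C where "C = max (M\<^sup>2 / \<delta>) (M\<^sup>2 / \<epsilon>)"
    obtain n where n: "n \<ge> N0" "f n > C * g n" using unb by blast
    obtain p where p: "p \<ge> N" "p < n" "\<epsilon> * f p < real n - real p" "f n \<le> M\<^sup>2 * f p"
      using N0[OF n(1)] by blast
    have small: "g n \<le> \<eta> * f p" if "\<eta> > 0" "M\<^sup>2 / \<eta> \<le> C" for \<eta>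
    proof -
      have "M\<^sup>2 / \<eta> * g n \<le> C * g n"
        using that(2) less_imp_le[OF gD(1)] by (rule mult_right_mono)
      then have "M\<^sup>2 / \<eta> * g n \<le> M\<^sup>2 * f p" using n(2) p(4) by linarith
      then show ?thesis using that(1) M by (simp add: field_simps)
    qed
    have g1: "g n \<le> \<epsilon> * f p" using small[OF \<epsilon>] by (simp add: C_def)
    have g2: "g n \<le> \<delta> * f p" using small[OF \<delta>] by (simp add: C_def)
    \<comment> \<open>Since \<open>g\<close> takes values in the naturals, a block of length exactly
      \<open>g n\<close> exists.\<close>
    obtain m where m: "g n = real m" using g unfolding H_up_def by (auto elim: Nats_cases)
    have mn: "real m < real n - real p" using g1 m p(3) by linarith
    have "p \<le> n - m" "m \<le> n" using mn by linarith+
    moreover have "g n \<le> \<delta> * f (n - m)"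
      using g2 mult_left_mono[OF monoD[OF fD(2) \<open>p \<le> n - m\<close>], of \<delta>] \<delta> by linarith
    ultimately show "\<exists>a b. N \<le> a \<and> a \<le> b \<and> real b - real a \<le> \<delta> * f a \<and> 1 * g b \<le> real b - real a"
      using p(1) m by (intro exI[of _ "n - m"] exI[of _ n]) (auto simp: of_nat_diff)
  qed
  then show False using Z by blast
qed

text \<open>Here \<open>f\<close> and \<open>g\<close> change roles in the block construction. The
  block starts at \<open>n\<close> with length about \<open>\<epsilon> * f n\<close>: short for
  \<open>g\<close>, as \<open>g n\<close> is huge compared with \<open>f n\<close>, and large for
  \<open>f\<close>, as \<open>f\<close> grows by at most the factor \<open>M\<close> across
  it.\<close>

lemma growth_imp_limsup_inverse_finite:
  assumes f: "f \<in> H_up" and g: "g \<in> H_up" and Z: "Z g \<subseteq> Z f"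
    and M: "M > 0" and \<epsilon>: "\<epsilon> > 0"
    and growth: "\<forall>\<^sub>F n in sequentially. f (n + nat \<lfloor>\<epsilon> * f n\<rfloor>) / f n \<le> M"
  shows "limsup (\<lambda>n. ereal (g n / f n)) < \<infinity>"
proof (rule ccontr)
  note fD = H_upD[OF f] and gD = H_upD[OF g]
  assume "\<not> ?thesis"
  then have unb: "\<exists>n\<ge>N. g n > C * f n" for C N
    using not_eventually_ratio_le[of f g] fD(1) by simp
  obtain N1 where N1: "\<And>n. n \<ge> N1 \<Longrightarrow> f (n + nat \<lfloor>\<epsilon> * f n\<rfloor>) / f n \<le> M"
    using growth unfolding eventually_sequentially by blast
  obtain N2 where N2: "\<And>n. n \<ge> N2 \<Longrightarrow> f n \<ge> 2 / \<epsilon>"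
    using fD(3) unfolding filterlim_at_top eventually_sequentially by meson
  have "\<exists>A. A \<in> Z g \<and> A \<notin> Z f"
  proof (rule exists_block_set[OF gD fD(1)])
    \<comment> \<open>The \<open>M\<close> pays for the growth of \<open>f\<close> over the block,
      the 2 for rounding its length down: once \<open>\<epsilon> * f n \<ge> 2\<close>, the floor is
      at least half of \<open>\<epsilon> * f n\<close>.\<close>
    show "\<epsilon> / (2 * M) > 0" using M \<epsilon> by simp
    fix \<delta> :: real and N :: nat assume \<delta>: "\<delta> > 0"
    obtain n where n: "n \<ge> max N (max N1 N2)" "g n > \<epsilon> / \<delta> * f n" using unb by blast
    define l where "l = nat \<lfloor>\<epsilon> * f n\<rfloor>"
    have ef: "\<epsilon> * f n \<ge> 2" using N2[of n] n(1) \<epsilon> by (simp add: field_simps)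
    have l: "real l \<le> \<epsilon> * f n" "\<epsilon> * f n / 2 \<le> real l" using ef unfolding l_def by linarith+
    have "\<epsilon> * f n \<le> \<delta> * g n" using n(2) \<delta> by (simp add: field_simps)
    then have "real l \<le> \<delta> * g n" using l(1) by linarith
    moreover have "\<epsilon> / (2 * M) * f (n + l) \<le> real l"
    proof -
      have "f (n + l) \<le> M * f n"
        using N1[of n] n(1) fD(1)[of n] by (simp add: l_def pos_divide_le_eq)
      then have "\<epsilon> / (2 * M) * f (n + l) \<le> \<epsilon> / (2 * M) * (M * f n)"
        using M \<epsilon> by (intro mult_left_mono) auto
      also have "\<dots> = \<epsilon> * f n / 2" using M by simp
      finally show ?thesis using l(2) by linarith
    qed
    ultimately show "\<exists>a b. N \<le> a \<and> a \<le> b \<and> real b - real a \<le> \<delta> * g a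
        \<and> \<epsilon> / (2 * M) * f b \<le> real b - real a"
      using n(1) by (intro exI[of _ n] exI[of _ "n + l"]) auto
  qed
  then show False using Z by blast
qed

section \<open>Flattening a function when the growth condition fails\<close>

lemma Z_antimono:
  assumes "\<And>n. g n > 0" "\<And>n. g n \<le> f n"
  shows "Z g \<subseteq> Z f"
proof
  fix A assume "A \<in> Z g"
  then have *: "(\<lambda>n. real (card (A \<inter> {..<n})) / g n) \<longlonglongrightarrow> 0" by (simp add: Z_def)
  have "(\<lambda>n. real (card (A \<inter> {..<n})) / f n) \<longlonglongrightarrow> 0"
  proof (rule tendsto_sandwich[OF _ _ tendsto_const *])
    show "\<forall>\<^sub>F n in sequentially. 0 \<le> real (card (A \<inter> {..<n})) / f n"
      using order_less_le_trans[OF assms] by (intro always_eventually allI divide_nonneg_pos) auto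
    show "\<forall>\<^sub>F n in sequentially. real (card (A \<inter> {..<n})) / f n \<le> real (card (A \<inter> {..<n})) / g n"
      using assms by (intro always_eventually allI frac_le) auto
  qed
  then show "A \<in> Z f" by (simp add: Z_def)
qed

text \<open>Passing from \<open>r n\<close> to \<open>n\<close> adds at most \<open>n - r n\<close>
  elements, which is negligible against \<open>f (r n)\<close>. The count up to \<open>r n\<close>
  is negligible as well, because \<open>r\<close> tends to infinity.\<close>

lemma Z_subset_compose:
  fixes f :: "nat \<Rightarrow> real"
  assumes f: "\<And>n. f n > 0"
    and r: "\<And>n. r n \<le> n" "filterlim r at_top sequentially"
    and gap: "(\<lambda>n. (real n - real (r n)) / f (r n)) \<longlonglongrightarrow> 0"
  shows "Z f \<subseteq> Z (\<lambda>n. f (r n))"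
proof
  fix A assume "A \<in> Z f"
  then have "(\<lambda>n. real (card (A \<inter> {..<n})) / f n) \<longlonglongrightarrow> 0" by (simp add: Z_def)
  then have "(\<lambda>n. real (card (A \<inter> {..<r n})) / f (r n)) \<longlonglongrightarrow> 0"
    using r(2) by (rule filterlim_compose)
  from tendsto_add[OF this gap]
  have *: "(\<lambda>n. real (card (A \<inter> {..<r n})) / f (r n) + (real n - real (r n)) / f (r n)) \<longlonglongrightarrow> 0"
    by simp
  have le: "real (card (A \<inter> {..<n})) / f (r n)
      \<le> real (card (A \<inter> {..<r n})) / f (r n) + (real n - real (r n)) / f (r n)" for n
  proof -
    have "card (A \<inter> {..<n}) \<le> card ((A \<inter> {..<r n}) \<union> {r n..<n})"
      by (intro card_mono) auto
    also have "\<dots> \<le> card (A \<inter> {..<r n}) + (n - r n)"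
      using card_Un_le[of "A \<inter> {..<r n}" "{r n..<n}"] by simp
    finally have "real (card (A \<inter> {..<n})) \<le> real (card (A \<inter> {..<r n})) + (real n - real (r n))"
      using r(1)[of n] by linarith
    then show ?thesis
      using f[of "r n"] by (simp add: divide_right_mono flip: add_divide_distrib)
  qed
  have "(\<lambda>n. real (card (A \<inter> {..<n})) / f (r n)) \<longlonglongrightarrow> 0"
  proof (rule tendsto_sandwich[OF _ _ tendsto_const *])
    show "\<forall>\<^sub>F n in sequentially. 0 \<le> real (card (A \<inter> {..<n})) / f (r n)"
      using f by (intro always_eventually allI) (simp add: less_imp_le)
  qed (use le in auto)
  then show "A \<in> Z (\<lambda>n. f (r n))" by (simp add: Z_def)
qed

text \<open>The witness is \<open>f\<close> composed with a map \<open>r\<close> that moves points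
  of a block back to its left end or further. The gaps \<open>n - r n\<close> are o(f (r n)), which
  preserves the ideal, while \<open>f\<close> at the right end of block \<open>k\<close> exceeds the
  new function by a factor above k+1.\<close>

lemma exists_inequivalent:
  assumes fH: "f \<in> H_up"
    and fail: "\<And>M \<epsilon>. M > 0 \<Longrightarrow> \<epsilon> > 0 \<Longrightarrow>
      \<not> (\<forall>\<^sub>F n in sequentially. f (n + nat \<lfloor>\<epsilon> * f n\<rfloor>) / f n \<le> M)"
  shows "\<exists>g\<in>H_up. Z f = Z g \<and> limsup (\<lambda>n. ereal (f n / g n)) = \<infinity>"
proof -
  note f = H_upD[OF fH]
  define e where "e k = 1 / real (Suc k)" for k
  \<comment> \<open>The failure is used with M = k+1 and \<epsilon> = 1/(k+1) together, so that the
    jumps grow while the relative block lengths shrink.\<close>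
  have "\<exists>a\<ge>k. f (a + nat \<lfloor>e k * f a\<rfloor>) > real (Suc k) * f a" for k
  proof -
    obtain a where "a \<ge> k" "\<not> f (a + nat \<lfloor>e k * f a\<rfloor>) / f a \<le> real (Suc k)"
      using fail[of "real (Suc k)" "e k"] unfolding eventually_sequentially e_def by auto
    then show ?thesis using f(1)[of a] by (auto simp: pos_divide_le_eq not_le)
  qed
  then obtain a where a: "\<And>k. a k \<ge> k"
    and jump: "\<And>k. f (a k + nat \<lfloor>e k * f (a k)\<rfloor>) > real (Suc k) * f (a k)" by metis
  define b where "b k = a k + nat \<lfloor>e k * f (a k)\<rfloor>" for k
  \<comment> \<open>The blocks \<open>{a k..b k}\<close> may overlap; taking the least candidate makes \<open>r\<close> monotone anyway.\<close>
  define r where "r n = (LEAST m. m = n \<or> (\<exists>k. m = a k \<and> n \<le> b k))" for n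
  have r_cases: "r n = n \<or> (\<exists>k. r n = a k \<and> n \<le> b k)" for n
    unfolding r_def by (rule LeastI[where k = n]) simp
  have r_le: "r n \<le> n" for n unfolding r_def by (rule Least_le) simp
  have r_le_a: "r n \<le> a k" if "n \<le> b k" for n k
    unfolding r_def by (rule Least_le) (use that in auto)
  have r_mono: "mono r"
  proof (rule monoI)
    fix n n' :: nat assume "n \<le> n'"
    from r_cases[of n'] show "r n \<le> r n'"
    proof (elim disjE exE conjE)
      assume "r n' = n'"
      then show ?thesis using r_le[of n] \<open>n \<le> n'\<close> by linarith
    next
      fix k assume "r n' = a k" "n' \<le> b k"
      then show ?thesis using r_le_a[of n k] \<open>n \<le> n'\<close> by linarith
    qed
  qed
  \<comment> \<open>To the right of the first blocks, only blocks of large index can move a point.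
    Both the divergence of \<open>r\<close> and the vanishing of the gaps follow from this.\<close>
  have far: "r n = n \<or> (\<exists>k\<ge>K. r n = a k \<and> n \<le> b k)" if "n > Max (b ` {..K})" for n K
  proof -
    have "n > b k" if "k \<le> K" for k
      using \<open>n > Max (b ` {..K})\<close> that by (simp add: Max_less_iff)
    then have "k \<ge> K" if "n \<le> b k" for k using that by (meson leD nat_le_linear)
    then show ?thesis using r_cases[of n] by blast
  qed
  have r_lim: "filterlim r at_top sequentially"
    unfolding filterlim_at_top eventually_sequentially
  proof
    fix K
    have "K \<le> r n" if "n \<ge> max K (Suc (Max (b ` {..K})))" for n
      using far[of K n] that order_trans[OF _ a] by (auto simp: Suc_le_eq)
    then show "\<exists>N. \<forall>n\<ge>N. K \<le> r n" by blast
  qed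
  have gap: "(\<lambda>n. (real n - real (r n)) / f (r n)) \<longlonglongrightarrow> 0"
  proof (rule LIMSEQ_I)
    fix \<delta> :: real assume \<delta>: "\<delta> > 0"
    then obtain K where K: "inverse (real (Suc K)) < \<delta>" using reals_Archimedean by blast
    have "norm ((real n - real (r n)) / f (r n) - 0) < \<delta>" if n: "n \<ge> Suc (Max (b ` {..K}))" for n
    proof -
      consider "r n = n" | k where "k \<ge> K" "r n = a k" "n \<le> b k"
        using far[of K n] n by (auto simp: Suc_le_eq)
      then show ?thesis
      proof cases
        case 1 then show ?thesis using \<delta> by simp
      next
        case (2 k)
        have "e k * f (a k) \<ge> 0" using f(1)[of "a k"] by (simp add: e_def)
        then have "real n - real (r n) \<le> e k * f (a k)"
          using 2 unfolding b_def by linarith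
        then have "(real n - real (r n)) / f (r n) \<le> e k"
          using f(1)[of "a k"] 2 by (simp add: pos_divide_le_eq)
        also have "\<dots> \<le> inverse (real (Suc K))"
          using 2(1) by (simp add: e_def divide_simps)
        finally show ?thesis using K r_le[of n] f(1)[of "r n"] by simp
      qed
    qed
    then show "\<exists>N. \<forall>n\<ge>N. norm ((real n - real (r n)) / f (r n) - 0) < \<delta>" by blast
  qed
  define g where "g n = f (r n)" for n
  have g_pos: "g n > 0" for n using f(1) by (simp add: g_def)
  have g_le: "g n \<le> f n" for n using monoD[OF f(2) r_le] by (simp add: g_def)
  have "\<not> (\<lambda>n. real n / g n) \<longlonglongrightarrow> 0"
  proof
    assume *: "(\<lambda>n. real n / g n) \<longlonglongrightarrow> 0"
    have "(\<lambda>n. real n / f n) \<longlonglongrightarrow> 0"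
    proof (rule tendsto_sandwich[OF _ _ tendsto_const *])
      show "\<forall>\<^sub>F n in sequentially. 0 \<le> real n / f n"
        using f(1) by (intro always_eventually allI) (simp add: less_imp_le)
      show "\<forall>\<^sub>F n in sequentially. real n / f n \<le> real n / g n"
        using g_pos g_le by (intro always_eventually allI frac_le) auto
    qed
    then show False using fH by (simp add: H_up_def G_def)
  qed
  moreover have "filterlim g at_top sequentially"
    unfolding g_def using f(3) r_lim by (rule filterlim_compose)
  moreover have "mono g" using f(2) r_mono by (auto simp: g_def mono_def)
  moreover have "range g \<subseteq> \<nat>" using fH by (auto simp: g_def H_up_def)
  ultimately have gH: "g \<in> H_up" using g_pos by (simp add: H_up_def G_def)
  have "Z f \<subseteq> Z g" using Z_subset_compose[OF f(1) r_le r_lim gap] by (simp add: g_def[abs_def])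
  then have Zeq: "Z f = Z g" using Z_antimono[of g f] g_pos g_le by blast
  have "\<not> limsup (\<lambda>n. ereal (f n / g n)) < \<infinity>"
    unfolding limsup_ereal_less_infinity_iff
  proof
    assume "\<exists>C. \<forall>\<^sub>F n in sequentially. f n / g n \<le> C"
    then obtain C N where C: "\<And>n. n \<ge> N \<Longrightarrow> f n / g n \<le> C"
      unfolding eventually_sequentially by blast
    obtain k where k: "real k \<ge> C" "k \<ge> N"
      using real_arch_simple[of "max C (real N)"] by auto
    \<comment> \<open>At \<open>b k\<close> the flattened function is at most
      \<open>f (a k)\<close>, so the jump of block \<open>k\<close> contradicts the bound
      \<open>C\<close> once k exceeds it.\<close>
    have "b k \<ge> N" using a[of k] k(2) by (simp add: b_def)
    then have "f (b k) \<le> C * g (b k)" using C[of "b k"] g_pos[of "b k"] by (simp add: pos_divide_le_eq)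
    also have "\<dots> \<le> real (Suc k) * g (b k)" using k(1) g_pos[of "b k"] by (intro mult_right_mono) auto
    also have "\<dots> \<le> real (Suc k) * f (a k)"
      using monoD[OF f(2) r_le_a[of "b k" k]] by (intro mult_left_mono) (auto simp: g_def)
    also have "\<dots> < f (b k)" using jump[of k] by (simp add: b_def)
    finally show False by simp
  qed
  then show ?thesis using gH Zeq by auto
qed

section \<open>Counting the equivalence classes\<close>

theorem theorem1:
  fixes f :: "nat \<Rightarrow> real"
  assumes "f \<in> H_up"
  shows "card (S f) = 1 \<longleftrightarrow>
    (\<exists>M>0. \<exists>\<epsilon>>0. \<forall>\<^sub>F n in sequentially.
       f (n + nat \<lfloor>\<epsilon> * f n\<rfloor>) / f n \<le> M)"
proof
  let ?A = "same_ideal f"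
  have eq: "equiv ?A (R_on ?A)"
    by (rule equiv_R_on) (auto simp: same_ideal_def H_up_def)
  have fA: "f \<in> ?A" using assms by (simp add: same_ideal_def)
  show "\<exists>M>0. \<exists>\<epsilon>>0. \<forall>\<^sub>F n in sequentially. f (n + nat \<lfloor>\<epsilon> * f n\<rfloor>) / f n \<le> M"
    if card: "card (S f) = 1"
  proof (rule ccontr)
    assume "\<not> ?thesis"
    then obtain g where g: "g \<in> H_up" "Z f = Z g" "limsup (\<lambda>n. ereal (f n / g n)) = \<infinity>"
      using exists_inequivalent[OF assms] by blast
    then have gA: "g \<in> ?A" by (simp add: same_ideal_def)
    obtain X where "S f = {X}" using card by (auto simp: card_1_singleton_iff)
    then have "R_on ?A `` {f} = R_on ?A `` {g}"
      using quotientI[OF fA, of "R_on ?A"] quotientI[OF gA, of "R_on ?A"] by (simp add: S_def)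
    then have "(f, g) \<in> R_on ?A" using eq_equiv_class[OF _ eq gA] by blast
    then show False using g(3) by (simp add: R_on_def)
  qed
  show "card (S f) = 1"
    if "\<exists>M>0. \<exists>\<epsilon>>0. \<forall>\<^sub>F n in sequentially. f (n + nat \<lfloor>\<epsilon> * f n\<rfloor>) / f n \<le> M"
  proof -
    obtain M \<epsilon> where M: "M > 0" "\<epsilon> > 0"
      "\<forall>\<^sub>F n in sequentially. f (n + nat \<lfloor>\<epsilon> * f n\<rfloor>) / f n \<le> M"
      using \<open>\<exists>M>0. _\<close> by blast
    \<comment> \<open>Equality of the ideals supplies both inclusions, one for each of the two upper
      limits in the relation.\<close>
    have rel: "(f, g) \<in> R_on ?A" if g: "g \<in> ?A" for g
      using g fA growth_imp_limsup_finite[OF assms _ _ M, of g]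
        growth_imp_limsup_inverse_finite[OF assms _ _ M, of g]
      by (simp add: R_on_def same_ideal_def)
    have "S f = {R_on ?A `` {f}}"
      using equiv_class_eq[OF eq rel] fA unfolding S_def quotient_def by blast
    then show ?thesis by simp
  qed
qed

end
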